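(* Let $p$ be a prime and let $s,d,w,z_1$ be positive integers with $1\le w\le p^d$ and $1\le z_1\le p^d-w+1$. Let $z_2$ be an integer such that $z_2=1$ if $w=1$, and $z_2\in\{w-1,w\}$ if $2\le w\le p^d$. Then there exists a directed strongly regular graph with parameters $(v,k,\lambda,\mu,t)$ given by $$v=(z_1+1)p^{2sd},\quad k=(p^{sd}-1)w+z_1z_2p^{sd},\quad \lambda=p^{sd}+w^2-3w+z_1z_2^2,$$ $$\mu=w^2-w+z_1z_2^2,\quad t=p^{sd}w-w+z_1z_2^2.$$
   Context: A directed strongly regular graph (DSRG) with parameters $(v,k,\lambda,\mu,t)$ is a finite directed graph $(V,E)$ without loops, with $|V|=v$ and $E\subseteq V\times V$, such that: (1) for every vertex $x$ there are exactly $k$ vertices $y$ with $(x,y)\in E$ and exactly $k$ vertices $z$ with $(z,x)\in E$; (2) for every vertex $x$ there are exactly $t$ vertices $y$ with both $(x,y)\in E$ and $(y,x)\in E$; (3) for any two distinct vertices $x,y$, the number of vertices $z$ with $(x,z)\in E$ and $(z,y)\in E$ is $\lambda$ if $(x,y)\in E$, and $\mu$ otherwise. The undirected case $t=k$ is allowed by this definition. *)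

theory Defs
  imports "Graph_Theory.Pair_Digraph" "HOL-Computational_Algebra.Primes"
begin

text \<open>
  The parameters are integers, although they count vertices, so that expressions such as
  \<open>q + w\<^sup>2 - 3 * w\<close> can be used as parameters without truncated subtraction.
  The counted vertices need no explicit membership in \<open>pverts G\<close>, since all arcs of a
  \<open>pair_digraph\<close> run between its vertices.
\<close>

locale directed_strongly_regular_graph = pair_digraph G
  for G :: "'a pair_pre_digraph" +
  fixes v k l m t :: int
  assumes card_verts: "int (card (pverts G)) = v"
    and out_regular: "x \<in> pverts G \<Longrightarrow> int (card {y. (x, y) \<in> parcs G}) = k"
    and in_regular: "x \<in> pverts G \<Longrightarrow> int (card {z. (z, x) \<in> parcs G}) = k"
    and reciprocal: "x \<in> pverts G \<Longrightarrow>
      int (card {y. (x, y) \<in> parcs G \<and> (y, x) \<in> parcs G}) = t"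
    and two_paths: "x \<in> pverts G \<Longrightarrow> y \<in> pverts G \<Longrightarrow> x \<noteq> y \<Longrightarrow>
      int (card {z. (x, z) \<in> parcs G \<and> (z, y) \<in> parcs G})
        = (if (x, y) \<in> parcs G then l else m)"

end

theory Submission
  imports "HOL-Algebra.Algebraic_Closure" "HOL-Number_Theory.Residues" Defs
begin

text \<open>
  Put \<open>q = p\<^bsup>sd\<^esup>\<close>. The parallel classes of lines of the affine plane over the field with
  \<open>q\<close> elements form an orthogonal array with \<open>q + 1\<close> columns, of which \<open>z\<^sub>1 + w\<close> are used:
  a private column for each of \<open>z\<^sub>1 + 1\<close> copies (blocks) of the plane, and \<open>w - 1\<close> columns common
  to all blocks. Inside block \<open>i\<close>, join distinct points that lie on a common line of one of the \<open>w\<close>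
  classes consisting of column \<open>i\<close> and the common columns; this is a Latin square graph. From block
  \<open>i\<close> to block \<open>j \<noteq> i\<close>, let \<open>x \<rightarrow> y\<close> depend only on the lines of column \<open>j\<close> through
  \<open>x\<close> and \<open>y\<close>, through a relation on the \<open>q\<close> lines with all in- and out-degrees
  \<open>z\<^sub>2\<close>. A path through a third block is then determined by conditions on two different columns, so
  there are \<open>z\<^sub>2\<^sup>2\<close> of them, while column \<open>j\<close> is a class of block \<open>j\<close> but not of block
  \<open>i\<close>. Hence the paths within blocks \<open>i\<close> and \<open>j\<close> contribute \<open>(2w - 1)z\<^sub>2\<close>, plus
  \<open>q - 2w\<close> along an arc, and \<open>z\<^sub>2 \<in> {w - 1, w}\<close> are exactly the solutions of
  \<open>z\<^sub>2\<^sup>2 - (2w - 1)z\<^sub>2 + w\<^sup>2 - w = 0\<close>, which makes these counts agree with the one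
  within a single block.
\<close>

section \<open>Finite fields\<close>

lemma (in cring) binomial_theorem:
  fixes n :: nat
  assumes [simp]: "a \<in> carrier R" "b \<in> carrier R"
  shows "(a \<oplus> b) [^] n = (\<Oplus>k\<in>{..n}. [(n choose k)] \<cdot> (a [^] k \<otimes> b [^] (n - k)))"
proof (induction n)
  case 0
  then show ?case by simp
next
  case (Suc n)
  define t where "t k = [(n choose k)] \<cdot> (a [^] Suc k \<otimes> b [^] (n - k))" for k
  define u where "u k = [(n choose k)] \<cdot> (a [^] k \<otimes> b [^] (Suc n - k))" for k
  have [simp]: "t k \<in> carrier R" "u k \<in> carrier R" for k
    by (auto simp: t_def u_def)
  have "(a \<oplus> b) [^] Suc n
      = (\<Oplus>k\<in>{..n}. [(n choose k)] \<cdot> (a [^] k \<otimes> b [^] (n - k))) \<otimes> (a \<oplus> b)"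
    by (simp add: Suc.IH)
  also have "\<dots> = (\<Oplus>k\<in>{..n}. ([(n choose k)] \<cdot> (a [^] k \<otimes> b [^] (n - k))) \<otimes> (a \<oplus> b))"
    by (rule finsum_ldistr) auto
  also have "\<dots> = (\<Oplus>k\<in>{..n}. t k \<oplus> u k)"
  proof (rule finsum_cong')
    fix k assume "k \<in> {..n}"
    then have "Suc n - k = Suc (n - k)" by auto
    then have "b [^] (Suc n - k) = b [^] (n - k) \<otimes> b"
      by simp
    moreover have "a [^] k \<otimes> b [^] (n - k) \<otimes> a = a [^] k \<otimes> a \<otimes> b [^] (n - k)"
      by (simp add: m_ac)
    ultimately show "([(n choose k)] \<cdot> (a [^] k \<otimes> b [^] (n - k))) \<otimes> (a \<oplus> b) = t k \<oplus> u k"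
      by (simp add: t_def u_def add_pow_ldistr r_distr m_assoc)
  qed auto
  also have "\<dots> = (\<Oplus>k\<in>{..n}. t k) \<oplus> (\<Oplus>k\<in>{..n}. u k)"
    by (rule finsum_addf) auto
  \<comment> \<open>The extra term carries the coefficient \<open>n choose Suc n\<close>, which is
    zero. With it the shifted \<open>u\<close> lines up with \<open>t\<close>, so that Pascal's rule
    merges the two sums.\<close>
  also have "(\<Oplus>k\<in>{..n}. u k) = (\<Oplus>k\<in>{..Suc n}. u k)"
  proof -
    have "u (Suc n) = \<zero>" by (simp add: u_def binomial_eq_0)
    then show ?thesis by simp
  qed
  also have "\<dots> = (\<Oplus>k\<in>{..n}. u (Suc k)) \<oplus> u 0"
    by (rule finsum_Suc2) auto
  also have "(\<Oplus>k\<in>{..n}. t k) \<oplus> ((\<Oplus>k\<in>{..n}. u (Suc k)) \<oplus> u 0)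
      = (\<Oplus>k\<in>{..n}. t k \<oplus> u (Suc k)) \<oplus> u 0"
    by (subst finsum_addf) (auto simp: a_assoc)
  also have "(\<Oplus>k\<in>{..n}. t k \<oplus> u (Suc k))
      = (\<Oplus>k\<in>{..n}. [(Suc n choose Suc k)] \<cdot> (a [^] Suc k \<otimes> b [^] (n - k)))"
    by (rule finsum_cong') (auto simp: t_def u_def add.nat_pow_mult)
  also have "\<dots> \<oplus> u 0 =
     (\<Oplus>k\<in>{..Suc n}. [(Suc n choose k)] \<cdot> (a [^] k \<otimes> b [^] (Suc n - k)))"
    by (subst finsum_Suc2) (auto simp: u_def)
  finally show ?case .
qed

text \<open>A prime divides all its inner binomial coefficients, so only the two outer terms of the
  expansion survive. Stating the characteristic as \<open>[p] \<cdot> \<one> = \<zero>\<close> lets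
  the lemma apply to polynomial rings as well as to fields.\<close>

lemma (in cring) frobenius_add:
  fixes p :: nat
  assumes p: "prime p" and char: "[p] \<cdot> \<one> = \<zero>"
    and [simp]: "a \<in> carrier R" "b \<in> carrier R"
  shows "(a \<oplus> b) [^] p = a [^] p \<oplus> b [^] p"
proof -
  obtain m where m: "p = Suc m"
    using prime_gt_0_nat[OF p] gr0_implies_Suc by blast
  have pow_zero: "[j] \<cdot> c = \<zero>" if "p dvd j" "c \<in> carrier R" for j :: nat and c
  proof -
    obtain i where "j = p * i" using \<open>p dvd j\<close> by (elim dvdE)
    moreover have "[j] \<cdot> c = ([j] \<cdot> \<one>) \<otimes> c"
      using that by (simp add: add_pow_ldistr)
    ultimately show ?thesis
      using that char by (metis add.nat_pow_one add.nat_pow_pow l_null one_closed)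
  qed
  define t where "t k = [(p choose k)] \<cdot> (a [^] k \<otimes> b [^] (p - k))" for k
  have [simp]: "t k \<in> carrier R" for k by (simp add: t_def)
  have mid: "t (Suc k) = \<zero>" if "k < m" for k
  proof -
    have "p dvd p choose Suc k"
      by (rule dvd_choose_prime) (use that m p in auto)
    then show ?thesis
      unfolding t_def by (rule pow_zero) simp
  qed
  have "(a \<oplus> b) [^] p = (\<Oplus>k\<in>{..Suc m}. t k)"
    by (simp add: binomial_theorem t_def m[symmetric])
  also have "\<dots> = (\<Oplus>k\<in>{..m}. t (Suc k)) \<oplus> t 0"
    by (rule finsum_Suc2) auto
  also have "(\<Oplus>k\<in>{..m}. t (Suc k)) = t (Suc m) \<oplus> (\<Oplus>k\<in>{..<m}. t (Suc k))"
    by (rule add.finprod_Suc3) auto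
  also have "(\<Oplus>k\<in>{..<m}. t (Suc k)) = \<zero>"
    by (rule add.finprod_one_eqI) (simp add: mid)
  finally show ?thesis
    by (simp add: t_def m[symmetric])
qed

lemma (in cring) frobenius_pow_add:
  fixes p :: nat
  assumes p: "prime p" and char: "[p] \<cdot> \<one> = \<zero>"
    and [simp]: "a \<in> carrier R" "b \<in> carrier R"
  shows "(a \<oplus> b) [^] (p ^ n) = a [^] (p ^ n) \<oplus> b [^] (p ^ n)"
proof (induction n)
  case (Suc n)
  have "(a \<oplus> b) [^] (p ^ Suc n) = ((a \<oplus> b) [^] (p ^ n)) [^] p"
    by (subst nat_pow_pow) (simp_all add: mult.commute)
  also have "\<dots> = (a [^] (p ^ n)) [^] p \<oplus> (b [^] (p ^ n)) [^] p"
    by (simp add: Suc.IH frobenius_add[OF p char])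
  finally show ?case
    by (subst (asm) (1 2) nat_pow_pow) (simp_all add: mult.commute)
qed simp

lemma add_pow_residue_ring:
  assumes "m > 1"
  shows "add_pow (residue_ring m) (k :: nat) 1 = int k mod m"
proof -
  interpret residues m "residue_ring m" by unfold_locales (use assms in auto)
  show ?thesis
    by (induction k) (auto simp: add_pow_def nat_pow_def residue_ring_def mod_simps add.commute)
qed

lemma (in ring_hom_ring) hom_add_pow:
  fixes k :: nat
  assumes "x \<in> carrier R"
  shows "h ([k] \<cdot>\<^bsub>R\<^esub> x) = [k] \<cdot>\<^bsub>S\<^esub> (h x)"
  using assms by (induction k) simp_all

section \<open>Finite fields as fixed points of a power of Frobenius\<close>

text \<open>The fixed points are the roots of X^q - X with q = p^n. Splitting supplies q roots
  counted with multiplicity, and since each root is simple, they are distinct.\<close>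

lemma (in field) card_frobenius_fixed_points:
  fixes p n :: nat
  assumes p: "prime p" and char: "[p] \<cdot> \<one> = \<zero>" and n: "n > 0"
    and split: "splitted (X [^]\<^bsub>poly_ring R\<^esub> (p ^ n) \<ominus>\<^bsub>poly_ring R\<^esub> X)"
  shows "card {a \<in> carrier R. a [^] (p ^ n) = a} = p ^ n"
proof -
  interpret UP: domain "poly_ring R"
    by (rule univ_poly_is_domain[OF carrier_is_subring])
  interpret C: ring_hom_ring R "poly_ring R" poly_of_const
    using canonical_embedding_ring_hom[OF carrier_is_subring] by simp
  define q where "q = p ^ n"
  define P where "P = X [^]\<^bsub>poly_ring R\<^esub> q \<ominus>\<^bsub>poly_ring R\<^esub> X"
  have q: "q \<ge> 2"
    unfolding q_def using prime_ge_2_nat[OF p] n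
    by (metis (no_types) le_trans less_eq_Suc_le One_nat_def self_le_power pos2 order_less_le_trans)
  have X[simp]: "X \<in> carrier (poly_ring R)"
    by (rule var_closed(1)[OF carrier_is_subring])
  have P[simp]: "P \<in> carrier (poly_ring R)"
    by (simp add: P_def)
  have eval_P: "eval P a = a [^] q \<ominus> a" if a: "a \<in> carrier R" for a
  proof -
    interpret E: ring_hom_ring "poly_ring R" R "\<lambda>f. eval f a"
      using eval_is_hom[OF carrier_is_subring a] UP.ring_axioms ring_axioms
      by (simp add: ring_hom_ringI2)
    show ?thesis
      using a E.hom_nat_pow[OF X, of q] by (simp add: P_def UP.minus_eq minus_eq eval_var)
  qed
  have deg: "degree P = q"
  proof -
    have pX: "X [^]\<^bsub>poly_ring R\<^esub> q = \<one> # replicate q \<zero>"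
      using unitary_monom_eq_var_pow[OF carrier_is_subring, of q] by (simp add: monom_def)
    have *: "degree (\<ominus>\<^bsub>poly_ring R\<^esub> X) = 1"
      using univ_poly_a_inv_degree[OF carrier_is_subring X] by (simp add: var_def)
    have "degree P = max (degree (X [^]\<^bsub>poly_ring R\<^esub> q)) (degree (\<ominus>\<^bsub>poly_ring R\<^esub> X))"
      unfolding P_def UP.minus_eq univ_poly_add
    proof (rule poly_add_degree_eq[OF carrier_is_subring])
      show "degree (X [^]\<^bsub>poly_ring R\<^esub> q) \<noteq> degree (\<ominus>\<^bsub>poly_ring R\<^esub> X)"
        using * q pX by simp
    qed (simp_all add: univ_poly_carrier)
    with * q pX show ?thesis by simp
  qed
  then have P0: "P \<noteq> []" using q by auto
  have root_iff: "is_root P a \<longleftrightarrow> a \<in> carrier R \<and> a [^] q = a" for a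
    using P0 eval_P by (auto simp: is_root_def)
  \<comment> \<open>Since \<open>a\<^bsup>q\<^esup> = a\<close>, Frobenius gives \<open>P = (X - a)\<^bsup>q\<^esup> - (X - a)\<close>, so \<open>a\<close> is a simple root.\<close>
  have simple: "\<not> [\<one>, \<ominus> a] [^]\<^bsub>poly_ring R\<^esub> (2 :: nat) pdivides P"
    if a: "a \<in> carrier R" and aq: "a [^] q = a" for a
  proof
    define c where "c = poly_of_const a"
    define Y where "Y = [\<one>, \<ominus> a]"
    assume "[\<one>, \<ominus> a] [^]\<^bsub>poly_ring R\<^esub> (2 :: nat) pdivides P"
    then obtain g where g[simp]: "g \<in> carrier (poly_ring R)"
      and Pg: "P = Y [^]\<^bsub>poly_ring R\<^esub> (2 :: nat) \<otimes>\<^bsub>poly_ring R\<^esub> g"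
      by (auto simp: pdivides_def factor_def Y_def)
    have c[simp]: "c \<in> carrier (poly_ring R)"
      using a by (simp add: c_def)
    have cq: "c [^]\<^bsub>poly_ring R\<^esub> q = c"
      using a aq C.hom_nat_pow[of a q] by (simp add: c_def)
    have Y[simp]: "Y \<in> carrier (poly_ring R)"
      using a by (auto simp: Y_def univ_poly_carrier[symmetric] polynomial_def)
    have Y0: "Y \<noteq> \<zero>\<^bsub>poly_ring R\<^esub>"
      by (simp add: Y_def univ_poly_zero)
    have XYc: "X = Y \<oplus>\<^bsub>poly_ring R\<^esub> c"
      using a by (simp add: Y_def c_def var_def poly_of_const_def univ_poly_add l_neg)
    have "[p] \<cdot>\<^bsub>poly_ring R\<^esub> \<one>\<^bsub>poly_ring R\<^esub> = \<zero>\<^bsub>poly_ring R\<^esub>"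
      using C.hom_add_pow[OF one_closed, of p] char by simp
    then have "X [^]\<^bsub>poly_ring R\<^esub> q = Y [^]\<^bsub>poly_ring R\<^esub> q \<oplus>\<^bsub>poly_ring R\<^esub> c"
      using UP.frobenius_pow_add[OF p _ Y c, of n] cq by (simp add: XYc q_def)
    then have "P = Y [^]\<^bsub>poly_ring R\<^esub> q \<oplus>\<^bsub>poly_ring R\<^esub> c \<ominus>\<^bsub>poly_ring R\<^esub> (Y \<oplus>\<^bsub>poly_ring R\<^esub> c)"
      unfolding P_def XYc[symmetric] by simp
    also have "\<dots> = Y [^]\<^bsub>poly_ring R\<^esub> q \<ominus>\<^bsub>poly_ring R\<^esub> Y"
      using UP.nat_pow_closed[OF Y, of q] Y c by (simp add: UP.minus_eq UP.minus_add UP.a_ac UP.r_neg2)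
    finally have PY: "P = Y [^]\<^bsub>poly_ring R\<^esub> q \<ominus>\<^bsub>poly_ring R\<^esub> Y" .
    \<comment> \<open>Comparing P = Y^q - Y with P = Y^2 g gives Y = Y^2 h. Cancelling one Y leaves
      1 = Y h, which becomes 1 = 0 on evaluation at the root \<open>a\<close> of Y.\<close>
    define h where "h = Y [^]\<^bsub>poly_ring R\<^esub> (q - 2) \<ominus>\<^bsub>poly_ring R\<^esub> g"
    have h[simp]: "h \<in> carrier (poly_ring R)" by (simp add: h_def)
    have "Y [^]\<^bsub>poly_ring R\<^esub> q = Y [^]\<^bsub>poly_ring R\<^esub> (2 :: nat) \<otimes>\<^bsub>poly_ring R\<^esub> Y [^]\<^bsub>poly_ring R\<^esub> (q - 2)"
      using UP.nat_pow_mult[OF Y, of 2 "q - 2"] q by (metis le_add_diff_inverse)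
    moreover have "Y = Y [^]\<^bsub>poly_ring R\<^esub> q \<ominus>\<^bsub>poly_ring R\<^esub> P"
      unfolding PY using UP.nat_pow_closed[OF Y, of q] Y
      by (simp add: UP.minus_eq UP.minus_add UP.a_ac UP.r_neg UP.r_neg2)
    ultimately have "Y = Y [^]\<^bsub>poly_ring R\<^esub> (2 :: nat) \<otimes>\<^bsub>poly_ring R\<^esub> h"
      unfolding Pg h_def
      by (simp add: UP.minus_eq UP.r_distr UP.r_minus)
    then have "Y \<otimes>\<^bsub>poly_ring R\<^esub> \<one>\<^bsub>poly_ring R\<^esub> = Y \<otimes>\<^bsub>poly_ring R\<^esub> (Y \<otimes>\<^bsub>poly_ring R\<^esub> h)"
      by (simp add: numeral_2_eq_2 UP.m_assoc)
    then have unit: "\<one>\<^bsub>poly_ring R\<^esub> = Y \<otimes>\<^bsub>poly_ring R\<^esub> h"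
      using UP.m_lcancel[OF Y0 Y UP.one_closed UP.m_closed[OF Y h]] by blast
    interpret E: ring_hom_ring "poly_ring R" R "\<lambda>f. eval f a"
      using eval_is_hom[OF carrier_is_subring a] UP.ring_axioms ring_axioms
      by (simp add: ring_hom_ringI2)
    have "eval Y a = \<zero>"
      using a by (simp add: Y_def r_neg)
    then have "\<one> = \<zero>"
      using arg_cong[OF unit, of "\<lambda>f. eval f a"] a by simp
    then show False by simp
  qed
  have count: "count (roots P) a = 1" if "a \<in># roots P" for a
  proof -
    have a: "a \<in> carrier R" "a [^] q = a"
      using that root_iff by (simp_all add: roots_mem_iff_is_root)
    have "\<not> 2 \<le> alg_mult P a"
      using le_alg_mult_imp_pdivides[OF a(1) P, of 2] simple[OF a] by blast
    moreover have "alg_mult P a = count (roots P) a"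
      using alg_mult_eq_count_roots[OF P] by simp
    ultimately show ?thesis
      using that by (simp add: count_greater_zero_iff[symmetric] del: count_greater_zero_iff)
  qed
  have "q = size (roots P)"
    using split deg by (simp add: P_def q_def splitted_def)
  also have "\<dots> = card (set_mset (roots P))"
    by (simp add: size_multiset_overloaded_eq count)
  also have "set_mset (roots P) = {a \<in> carrier R. a [^] q = a}"
    by (auto simp: roots_mem_iff_is_root root_iff)
  finally show ?thesis
    by (simp add: q_def)
qed

text \<open>The field is cut out of an algebraic closure of the integers mod p as the fixed points
  of the map taking a to a^(p^n). The element type is the one in which
  \<open>field.exists_closure\<close> builds that closure.\<close>

lemma exists_finite_field:
  fixes p n :: nat
  assumes p: "prime p" and n: "n > 0"
  shows "\<exists>F :: (((int list \<times> nat) multiset) \<Rightarrow> int) ring. field F \<and> card (carrier F) = p ^ n"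
proof -
  have Z: "field (residue_ring (int p))"
    by (rule residues_prime.is_field) (rule residues_prime.intro, rule p)
  define e :: "int \<Rightarrow> (int list \<times> nat) multiset \<Rightarrow> int"
    where "e = ring.indexed_const (residue_ring (int p))"
  obtain L :: "(((int list \<times> nat) multiset) \<Rightarrow> int) ring"
    where closure: "algebraic_closure L (e ` carrier (residue_ring (int p)))"
      and hom: "e \<in> ring_hom (residue_ring (int p)) L"
    unfolding e_def by (rule field.exists_closure[OF Z])
  define K where "K = e ` carrier (residue_ring (int p))"
  interpret L: algebraic_closure L K
    using closure by (simp add: K_def)
  interpret hom: ring_hom_ring "residue_ring (int p)" L e
    using field.is_ring[OF Z] L.ring_axioms hom by (rule ring_hom_ringI2)
  have K: "subring K L" by (rule subfieldE(1)[OF L.subfield_axioms])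
  have "[p] \<cdot>\<^bsub>residue_ring (int p)\<^esub> \<one>\<^bsub>residue_ring (int p)\<^esub> = \<zero>\<^bsub>residue_ring (int p)\<^esub>"
    using add_pow_residue_ring[of "int p" p] prime_gt_1_nat[OF p]
    by (simp add: residue_ring_def)
  then have char: "[p] \<cdot>\<^bsub>L\<^esub> \<one>\<^bsub>L\<^esub> = \<zero>\<^bsub>L\<^esub>"
    using hom.hom_add_pow[of "\<one>\<^bsub>residue_ring (int p)\<^esub>" p] by simp
  \<comment> \<open>The closure splits polynomials with coefficients in the embedded prime field K,
    so X^(p^n) - X has to be recognised as the same polynomial over K and over L.\<close>
  have "X\<^bsub>L\<^esub> [^]\<^bsub>poly_ring L\<^esub> (p ^ n) = X\<^bsub>L\<^esub> [^]\<^bsub>K[X]\<^bsub>L\<^esub>\<^esub> (p ^ n)"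
    using L.unitary_monom_eq_var_pow[OF K] L.unitary_monom_eq_var_pow[OF L.carrier_is_subring]
    by metis
  then have "X\<^bsub>L\<^esub> [^]\<^bsub>poly_ring L\<^esub> (p ^ n) \<ominus>\<^bsub>poly_ring L\<^esub> X\<^bsub>L\<^esub>
      = X\<^bsub>L\<^esub> [^]\<^bsub>K[X]\<^bsub>L\<^esub>\<^esub> (p ^ n) \<ominus>\<^bsub>K[X]\<^bsub>L\<^esub>\<^esub> X\<^bsub>L\<^esub>"
    by (simp only: L.univ_poly_a_minus_consistent[OF K L.var_closed(1)[OF K]])
  moreover have "X\<^bsub>L\<^esub> [^]\<^bsub>K[X]\<^bsub>L\<^esub>\<^esub> (p ^ n) \<ominus>\<^bsub>K[X]\<^bsub>L\<^esub>\<^esub> X\<^bsub>L\<^esub> \<in> carrier (K[X]\<^bsub>L\<^esub>)"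
    by (intro ring.ring_simprules(4)[OF L.univ_poly_is_ring[OF K]]
        L.var_pow_closed[OF K] L.var_closed(1)[OF K])
  ultimately have split: "L.splitted (X\<^bsub>L\<^esub> [^]\<^bsub>poly_ring L\<^esub> (p ^ n) \<ominus>\<^bsub>poly_ring L\<^esub> X\<^bsub>L\<^esub>)"
    using L.roots_over_subfield by simp
  define F where "F = {a \<in> carrier L. a [^]\<^bsub>L\<^esub> (p ^ n) = a}"
  have card: "card F = p ^ n"
    unfolding F_def by (rule L.card_frobenius_fixed_points[OF p char n split])
  have "subfield F L"
  proof (rule L.subfieldI')
    show "subring F L"
    proof (rule L.subringI)
      fix a assume "a \<in> F"
      then have a: "a \<in> carrier L" "a [^]\<^bsub>L\<^esub> (p ^ n) = a" by (auto simp: F_def)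
      \<comment> \<open>Expanding the power of a + (-a) by additivity shows that the power of -a is
        -a, without distinguishing even from odd p.\<close>
      have "\<zero>\<^bsub>L\<^esub> = (a \<oplus>\<^bsub>L\<^esub> \<ominus>\<^bsub>L\<^esub> a) [^]\<^bsub>L\<^esub> (p ^ n)"
        using a p by (simp add: L.r_neg L.nat_pow_zero prime_gt_0_nat)
      also have "\<dots> = a \<oplus>\<^bsub>L\<^esub> (\<ominus>\<^bsub>L\<^esub> a) [^]\<^bsub>L\<^esub> (p ^ n)"
        using a L.frobenius_pow_add[OF p char, of a "\<ominus>\<^bsub>L\<^esub> a" n] by simp
      finally show "\<ominus>\<^bsub>L\<^esub> a \<in> F"
        using a by (auto simp: F_def intro!: L.minus_equality[symmetric] simp: L.a_comm)
    next
      fix a b assume "a \<in> F" "b \<in> F"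
      then show "a \<otimes>\<^bsub>L\<^esub> b \<in> F" "a \<oplus>\<^bsub>L\<^esub> b \<in> F"
        using L.frobenius_pow_add[OF p char]
        by (auto simp: F_def L.nat_pow_distrib)
    qed (auto simp: F_def)
    fix a assume "a \<in> F - {\<zero>\<^bsub>L\<^esub>}"
    then have a: "a \<in> carrier L" "a [^]\<^bsub>L\<^esub> (p ^ n) = a" "a \<in> Units L"
      by (auto simp: F_def L.field_Units)
    then have "a \<otimes>\<^bsub>L\<^esub> (inv\<^bsub>L\<^esub> a) [^]\<^bsub>L\<^esub> (p ^ n) = \<one>\<^bsub>L\<^esub>"
      using L.nat_pow_distrib[of a "inv\<^bsub>L\<^esub> a" "p ^ n"] by simp
    then have "inv\<^bsub>L\<^esub> a = (inv\<^bsub>L\<^esub> a) [^]\<^bsub>L\<^esub> (p ^ n)"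
      using a by (intro L.comm_inv_char) simp_all
    then show "inv\<^bsub>L\<^esub> a \<in> F"
      using a by (simp add: F_def)
  qed
  then have "field (L\<lparr>carrier := F\<rparr>)"
    by (rule L.subfield_iff(2))
  with card show ?thesis
    by (intro exI[of _ "L\<lparr>carrier := F\<rparr>"]) simp
qed

section \<open>Orthogonal arrays from affine planes\<close>

text \<open>Geometrically, \<open>x\<close> is a point, \<open>c\<close> a parallel class, and
  \<open>f c x\<close> the line of class \<open>c\<close> through \<open>x\<close>. With at least
  two columns, the bijections also confine every entry to values below \<open>q\<close>.\<close>

locale orthogonal_array =
  fixes q r :: nat and f :: "nat \<Rightarrow> nat \<Rightarrow> nat"
  assumes two_columns: "2 \<le> r"
    and bij: "c < r \<Longrightarrow> c' < r \<Longrightarrow> c \<noteq> c' \<Longrightarrow>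
      bij_betw (\<lambda>x. (f c x, f c' x)) {..<q\<^sup>2} ({..<q} \<times> {..<q})"
begin

lemma entry_less:
  assumes "c < r" "x < q\<^sup>2"
  shows "f c x < q"
proof -
  obtain c' where "c' < r" "c' \<noteq> c"
    using two_columns that[of 0] that[of 1] by (cases "c = 0") auto
  then have "(f c x, f c' x) \<in> {..<q} \<times> {..<q}"
    using bij_betw_apply[OF bij] assms by blast
  then show ?thesis by simp
qed

lemma eq_imp_eq:
  assumes "c < r" "c' < r" "c \<noteq> c'" "x < q\<^sup>2" "y < q\<^sup>2" "f c x = f c y" "f c' x = f c' y"
  shows "x = y"
  using bij_betw_imp_inj_on[OF bij[OF assms(1-3)]] assms(4-7) by (auto dest: inj_onD)

text \<open>Lines of different classes meet in exactly one point, so conditions on two columns are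
  independent. The bounds on \<open>P\<close> and \<open>Q\<close> keep the right-hand side from
  counting labels that are not lines.\<close>

lemma card_two:
  assumes c: "c < r" "c' < r" "c \<noteq> c'" and P: "\<And>a. P a \<Longrightarrow> a < q" "\<And>a. Q a \<Longrightarrow> a < q"
  shows "card {x. x < q\<^sup>2 \<and> P (f c x) \<and> Q (f c' x)} = card {a. P a} * card {a. Q a}"
proof -
  let ?g = "\<lambda>x. (f c x, f c' x)"
  have g: "inj_on ?g {..<q\<^sup>2}" "?g ` {..<q\<^sup>2} = {..<q} \<times> {..<q}"
    using bij[OF c] by (auto simp: bij_betw_def)
  have "?g ` {x. x < q\<^sup>2 \<and> P (f c x) \<and> Q (f c' x)} = {a. P a} \<times> {a. Q a}"
  proof (intro equalityI subsetI)
    fix u assume u: "u \<in> {a. P a} \<times> {a. Q a}"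
    then have "u \<in> ?g ` {..<q\<^sup>2}"
      unfolding g(2) using P by auto
    with u show "u \<in> ?g ` {x. x < q\<^sup>2 \<and> P (f c x) \<and> Q (f c' x)}"
      by auto
  qed auto
  moreover have "inj_on ?g {x. x < q\<^sup>2 \<and> P (f c x) \<and> Q (f c' x)}"
    by (rule inj_on_subset[OF g(1)]) auto
  ultimately show ?thesis
    by (simp flip: card_cartesian_product add: card_image[symmetric])
qed

text \<open>A vacuous condition on a second column reduces this to \<open>card_two\<close>; each
  line has \<open>q\<close> points.\<close>

lemma card_one:
  assumes c: "c < r" and P: "\<And>a. P a \<Longrightarrow> a < q"
  shows "card {x. x < q\<^sup>2 \<and> P (f c x)} = card {a. P a} * q"
proof -
  obtain c' where c': "c' < r" "c' \<noteq> c"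
    using two_columns that[of 0] that[of 1] by (cases "c = 0") auto
  have "card {x. x < q\<^sup>2 \<and> P (f c x) \<and> f c' x < q} = card {a. P a} * card {a. a < q}"
    by (rule card_two) (use c c' P in auto)
  moreover have "{x. x < q\<^sup>2 \<and> P (f c x) \<and> f c' x < q} = {x. x < q\<^sup>2 \<and> P (f c x)}"
    using entry_less[OF c'(1)] by blast
  ultimately show ?thesis by simp
qed

definition adj :: "nat set \<Rightarrow> nat \<Rightarrow> nat \<Rightarrow> bool"
  where "adj S x y \<longleftrightarrow> x \<noteq> y \<and> (\<exists>c\<in>S. f c y = f c x)"

lemma adj_sym: "adj S x y \<longleftrightarrow> adj S y x"
  by (metis adj_def)

text \<open>The correction term is there because \<open>x\<close> itself lies in all of the \<open>card S\<close> classes on the right.\<close>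

lemma card_adj_plus:
  assumes S: "S \<subseteq> {..<r}" and x: "x < q\<^sup>2"
  shows "card {y. y < q\<^sup>2 \<and> adj S x y \<and> P y} + card S * of_bool (P x)
    = (\<Sum>c\<in>S. card {y. y < q\<^sup>2 \<and> f c y = f c x \<and> P y})"
proof -
  have fin: "finite S" using finite_subset[OF S] by simp
  let ?A = "\<lambda>c. {y. y < q\<^sup>2 \<and> f c y = f c x \<and> P y}"
  \<comment> \<open>Two lines through \<open>x\<close> of different classes share no other point, so
    they become disjoint once \<open>x\<close> is deleted.\<close>
  have "{y. y < q\<^sup>2 \<and> adj S x y \<and> P y} = (\<Union>c\<in>S. ?A c - {x})"
    by (auto simp: adj_def)
  moreover have "card (\<Union>c\<in>S. ?A c - {x}) = (\<Sum>c\<in>S. card (?A c - {x}))"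
  proof (rule card_UN_disjoint)
    show "\<forall>c\<in>S. \<forall>c'\<in>S. c \<noteq> c' \<longrightarrow> (?A c - {x}) \<inter> (?A c' - {x}) = {}"
      using eq_imp_eq[OF _ _ _ _ x] S by blast
  qed (use fin in auto)
  ultimately have "card {y. y < q\<^sup>2 \<and> adj S x y \<and> P y} + card S * of_bool (P x)
      = (\<Sum>c\<in>S. card (?A c - {x}) + of_bool (P x))"
    by (simp add: sum.distrib)
  also have "\<dots> = (\<Sum>c\<in>S. card (?A c))"
  proof (rule sum.cong)
    fix c
    show "card (?A c - {x}) + of_bool (P x) = card (?A c)"
    proof (cases "P x")
      case True
      have "finite (?A c)" "x \<in> ?A c" using True x by auto
      from card.remove[OF this] True show ?thesis by simp
    qed simp
  qed simp
  finally show ?thesis .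
qed

lemma card_adj:
  assumes S: "S \<subseteq> {..<r}" and x: "x < q\<^sup>2"
  shows "card {y. y < q\<^sup>2 \<and> adj S x y} + card S = card S * q"
proof -
  have "card {y. y < q\<^sup>2 \<and> f c y = f c x} = q" if "c \<in> S" for c
    using card_one[of c "\<lambda>a. a = f c x"] that S x entry_less[of c x] by auto
  then show ?thesis
    using card_adj_plus[OF S x, of "\<lambda>_. True"] by simp
qed

text \<open>If \<open>y\<close> lies on the line of class \<open>c\<close> through \<open>x\<close>,
  every other point of that line is adjacent to \<open>y\<close>. Otherwise each line through
  \<open>y\<close> from the other \<open>card S - 1\<close> classes meets it once, and the parallel
  through \<open>y\<close> not at all.\<close>

lemma card_class_adj:
  assumes S: "S \<subseteq> {..<r}" and xy: "x < q\<^sup>2" "y < q\<^sup>2" "x \<noteq> y" and c: "c \<in> S"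
  shows "card {z. z < q\<^sup>2 \<and> f c z = f c x \<and> adj S z y}
    = (if f c y = f c x then q - 1 else card S - 1)"
proof (cases "f c y = f c x")
  case True
  have "{z. z < q\<^sup>2 \<and> f c z = f c x \<and> adj S z y} = {z. z < q\<^sup>2 \<and> f c z = f c x} - {y}"
    using True c by (auto simp: adj_def intro!: bexI[of _ c])
  moreover have "card {z. z < q\<^sup>2 \<and> f c z = f c x} = q"
    using card_one[of c "\<lambda>a. a = f c x"] c S xy entry_less[of c x] by auto
  ultimately show ?thesis
    using True xy by (auto simp: card_Diff_singleton_if)
next
  case False
  have fin: "finite S" using finite_subset[OF S] by simp
  have "{z. z < q\<^sup>2 \<and> f c z = f c x \<and> adj S z y} = {z. z < q\<^sup>2 \<and> adj S y z \<and> f c z = f c x}"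
    using adj_sym by blast
  then have "card {z. z < q\<^sup>2 \<and> f c z = f c x \<and> adj S z y}
      = (\<Sum>c'\<in>S. card {z. z < q\<^sup>2 \<and> f c' z = f c' y \<and> f c z = f c x})"
    using card_adj_plus[OF S xy(2), of "\<lambda>z. f c z = f c x"] False by simp
  also have "\<dots> = (\<Sum>c'\<in>S. of_bool (c' \<noteq> c))"
  proof (rule sum.cong)
    fix c' assume "c' \<in> S"
    have "card {z. z < q\<^sup>2 \<and> f c' z = f c' y \<and> f c z = f c x} = 1" if "c' \<noteq> c"
      using card_two[of c' c "\<lambda>a. a = f c' y" "\<lambda>a. a = f c x"] that S c \<open>c' \<in> S\<close> xy
        entry_less[of c' y] entry_less[of c x] by auto
    then show "card {z. z < q\<^sup>2 \<and> f c' z = f c' y \<and> f c z = f c x} = of_bool (c' \<noteq> c)"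
      using False by auto
  qed simp
  also have "\<dots> = card (S - {c})"
    using fin by (simp add: Collect_conj_eq set_diff_eq)
  finally show ?thesis
    using c fin False by simp
qed

text \<open>Common neighbours are counted along the lines through \<open>x\<close>. If
  \<open>x\<close> and \<open>y\<close> are adjacent, exactly one of these lines contains
  \<open>y\<close>, giving (q - 1) + (|S| - 1)^2, less |S| for the overcounting of \<open>x\<close>.
  Otherwise every line contributes |S| - 1.\<close>

lemma card_adj_adj:
  assumes S: "S \<subseteq> {..<r}" "S \<noteq> {}" and xy: "x < q\<^sup>2" "y < q\<^sup>2" "x \<noteq> y" and q: "q > 0"
  shows "int (card {z. z < q\<^sup>2 \<and> adj S x z \<and> adj S z y})
    = (if adj S x y then int q + (int (card S))\<^sup>2 - 3 * int (card S)
       else (int (card S))\<^sup>2 - int (card S))"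
proof -
  have fin: "finite S" using finite_subset[OF S(1)] by simp
  then have S1: "card S \<ge> 1" using S by (simp add: Suc_le_eq card_gt_0_iff)
  have *: "card {z. z < q\<^sup>2 \<and> adj S x z \<and> adj S z y} + card S * of_bool (adj S x y)
    = (\<Sum>c\<in>S. if f c y = f c x then q - 1 else card S - 1)"
    unfolding card_adj_plus[OF S(1) xy(1), of "\<lambda>z. adj S z y"]
    by (intro sum.cong refl card_class_adj[OF S(1) xy])
  show ?thesis
  proof (cases "adj S x y")
    case True
    then obtain d where d: "d \<in> S" "f d y = f d x" by (auto simp: adj_def)
    have "f c y = f c x \<longleftrightarrow> c = d" if "c \<in> S" for c
      using eq_imp_eq[of c d y x] d S that xy by auto
    then have "(\<Sum>c\<in>S. if f c y = f c x then q - 1 else card S - 1)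
        = (\<Sum>c\<in>S. if c = d then q - 1 else card S - 1)"
      by (intro sum.cong) auto
    also have "\<dots> = (q - 1) + (\<Sum>c\<in>S - {d}. card S - 1)"
      using d fin by (subst sum.remove[of S d]) (auto intro!: sum.cong)
    also have "\<dots> = (q - 1) + (card S - 1) * (card S - 1)"
      using d fin by simp
    finally have "card {z. z < q\<^sup>2 \<and> adj S x z \<and> adj S z y} + card S
        = (q - 1) + (card S - 1) * (card S - 1)"
      using * True by simp
    from arg_cong[OF this, of int]
    have "int (card {z. z < q\<^sup>2 \<and> adj S x z \<and> adj S z y}) + int (card S)
        = (int q - 1) + (int (card S) - 1) * (int (card S) - 1)"
      using q S1 by (simp add: of_nat_diff)
    with True show ?thesis
      by (simp add: algebra_simps power2_eq_square)
  next
    case False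
    then have "f c y \<noteq> f c x" if "c \<in> S" for c
      using that xy by (auto simp: adj_def)
    then have "(\<Sum>c\<in>S. if f c y = f c x then q - 1 else card S - 1) = card S * (card S - 1)"
      by simp
    with * False have "int (card {z. z < q\<^sup>2 \<and> adj S x z \<and> adj S z y}) = int (card S) * (int (card S) - 1)"
      using S1 by (simp add: of_nat_diff)
    with False show ?thesis
      by (simp add: algebra_simps power2_eq_square)
  qed
qed

end

lemma (in orthogonal_array) fewer_columns:
  assumes "2 \<le> r'" "r' \<le> r"
  shows "orthogonal_array q r' f"
  using assms bij by unfold_locales auto

section \<open>The array of the affine plane over a finite field\<close>

lemma bij_betw_if_inj_on_card:
  assumes "inj_on g A" "g ` A \<subseteq> B" "finite B" "card A = card B"
  shows "bij_betw g A B"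
  using assms by (metis bij_betw_def card_image card_subset_eq)

text \<open>A line of slope k is labelled by its intercept y - k x. Equal labels give y - y' = k (x
  - x'), and two different slopes force both differences to vanish.\<close>

lemma (in field) two_lines_meet:
  assumes [simp]: "m \<in> carrier R" "m' \<in> carrier R" "x \<in> carrier R" "x' \<in> carrier R"
      "y \<in> carrier R" "y' \<in> carrier R"
    and neq: "m \<noteq> m'"
    and eq: "y \<ominus> m \<otimes> x = y' \<ominus> m \<otimes> x'" "y \<ominus> m' \<otimes> x = y' \<ominus> m' \<otimes> x'"
  shows "x = x' \<and> y = y'"
proof -
  have diff: "y \<ominus> y' = k \<otimes> (x \<ominus> x')"
    if [simp]: "k \<in> carrier R" and k: "y \<ominus> k \<otimes> x = y' \<ominus> k \<otimes> x'" for k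
  proof -
    have "y \<ominus> y' = (y \<ominus> k \<otimes> x) \<oplus> (k \<otimes> x \<ominus> y')"
      by (simp add: minus_eq a_assoc r_neg1 r_neg2)
    also have "\<dots> = k \<otimes> (x \<ominus> x')"
      unfolding k by (simp add: minus_eq r_distr r_minus a_ac r_neg1 r_neg2)
    finally show ?thesis .
  qed
  have "m \<otimes> (x \<ominus> x') = m' \<otimes> (x \<ominus> x')"
    using diff[OF _ eq(1)] diff[OF _ eq(2)] by simp
  then have "x \<ominus> x' = \<zero>"
    using neq m_rcancel[of "x \<ominus> x'" m m'] by auto
  moreover from this have "y \<ominus> y' = \<zero>"
    unfolding diff[OF assms(1) eq(1)] by (simp only: r_null assms(1))
  ultimately show ?thesis
    by (simp add: r_right_minus_eq)
qed

lemma exists_orthogonal_array: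
  fixes p n :: nat
  assumes p: "prime p" and n: "n > 0"
  shows "\<exists>f. orthogonal_array (p ^ n) (p ^ n + 1) f"
proof -
  obtain K :: "(((int list \<times> nat) multiset) \<Rightarrow> int) ring"
    where K: "field K" "card (carrier K) = p ^ n"
    using exists_finite_field[OF p n] by blast
  interpret field K by (fact K(1))
  define q where "q = p ^ n"
  have q: "q > 0" using prime_gt_0_nat[OF p] by (simp add: q_def)
  have fin: "finite (carrier K)" and card: "card (carrier K) = q"
    using K q by (auto simp: q_def intro: card_ge_0_finite)
  obtain g where g: "bij_betw g {0..<q} (carrier K)"
    using ex_bij_betw_nat_finite[OF fin] card by metis
  obtain h where h: "bij_betw h {0..<q\<^sup>2} (carrier K \<times> carrier K)"
    using ex_bij_betw_nat_finite[of "carrier K \<times> carrier K"] fin card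
    by (metis card_cartesian_product finite_cartesian_product power2_eq_square)
  define g' where "g' = inv_into {0..<q} g"
  have g': "bij_betw g' (carrier K) {0..<q}"
    unfolding g'_def by (rule bij_betw_inv_into[OF g])
  \<comment> \<open>Column \<open>q\<close> is the class of vertical lines, labelled by abscissa; a
    column c < q has slope \<open>g c\<close> and intercepts as labels.\<close>
  define col where "col c u = (if c = q then fst u else snd u \<ominus>\<^bsub>K\<^esub> g c \<otimes>\<^bsub>K\<^esub> fst u)" for c u
  define f where "f c x = g' (col c (h x))" for c x
  have g_in: "g c \<in> carrier K" if "c < q" for c
    using bij_betw_apply[OF g, of c] that by simp
  have h_in: "h x \<in> carrier K \<times> carrier K" if "x < q\<^sup>2" for x
    using bij_betw_apply[OF h, of x] that by simp
  have col_in: "col c (h x) \<in> carrier K" if "c < q + 1" "x < q\<^sup>2" for c x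
    using h_in[OF that(2)] g_in[of c] that(1) by (auto simp: col_def mem_Times_iff)
  \<comment> \<open>With \<open>c < c'\<close>, only \<open>c'\<close> can be the vertical
    class.\<close>
  have col_inj: "u = v"
    if c: "c < q + 1" "c' < q + 1" "c < c'"
      and u: "u \<in> carrier K \<times> carrier K" "v \<in> carrier K \<times> carrier K"
      and eq: "col c u = col c v" "col c' u = col c' v" for c c' u v
  proof -
    obtain x y x' y' where uv: "u = (x, y)" "v = (x', y')"
      by (cases u, cases v) auto
    have K_in: "x \<in> carrier K" "y \<in> carrier K" "x' \<in> carrier K" "y' \<in> carrier K"
      using u uv by auto
    show ?thesis
    proof (cases "c' = q")
      case True
      then have "x = x'" "y \<ominus>\<^bsub>K\<^esub> g c \<otimes>\<^bsub>K\<^esub> x = y' \<ominus>\<^bsub>K\<^esub> g c \<otimes>\<^bsub>K\<^esub> x"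
        using eq c by (auto simp: col_def uv)
      then show ?thesis
        using K_in g_in[of c] c True by (simp add: uv minus_eq)
    next
      case False
      with c have lt: "c < q" "c' < q" by auto
      then have "g c \<noteq> g c'"
        using c(3) bij_betw_imp_inj_on[OF g] by (auto dest: inj_onD)
      then show ?thesis
        using two_lines_meet[of "g c" "g c'" x x' y y'] K_in g_in lt eq False
        by (simp add: col_def uv)
    qed
  qed
  have "orthogonal_array q (q + 1) f"
  proof
    show "2 \<le> q + 1" using q by simp
    fix c c' assume c: "c < q + 1" "c' < q + 1" "c \<noteq> c'"
    show "bij_betw (\<lambda>x. (f c x, f c' x)) {..<q\<^sup>2} ({..<q} \<times> {..<q})"
    proof (rule bij_betw_if_inj_on_card)
      show "(\<lambda>x. (f c x, f c' x)) ` {..<q\<^sup>2} \<subseteq> {..<q} \<times> {..<q}"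
        using bij_betw_apply[OF g'] col_in c by (auto simp: f_def)
      show "inj_on (\<lambda>x. (f c x, f c' x)) {..<q\<^sup>2}"
      proof (rule inj_onI)
        fix x y assume xy: "x \<in> {..<q\<^sup>2}" "y \<in> {..<q\<^sup>2}" "(f c x, f c' x) = (f c y, f c' y)"
        have "col d (h x) = col d (h y)" if "d < q + 1" "f d x = f d y" for d
          using that xy col_in bij_betw_imp_inj_on[OF g'] by (auto simp: f_def dest: inj_onD)
        then have "col c (h x) = col c (h y)" "col c' (h x) = col c' (h y)"
          using xy c by auto
        then have "h x = h y"
          using col_inj[of c c'] col_inj[of c' c] c xy h_in by (cases c c' rule: linorder_cases) auto
        then show "x = y"
          using xy bij_betw_imp_inj_on[OF h] by (auto dest: inj_onD)
      qed
    qed (simp_all add: power2_eq_square)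
  qed
  then show ?thesis by (auto simp: q_def)
qed

section \<open>Block graphs of orthogonal arrays\<close>

text \<open>A vertex number \<open>u\<close> encodes point \<open>u mod n\<close> of block
  \<open>u div n\<close>. This reduces counts of vertices to sums over blocks.\<close>

lemma card_div_mod:
  fixes m n :: nat
  assumes "n > 0"
  shows "card {u. u < m * n \<and> P (u div n) (u mod n)} = (\<Sum>i<m. card {x. x < n \<and> P i x})"
proof -
  have "bij_betw (\<lambda>u. (u div n, u mod n)) {u. u < m * n \<and> P (u div n) (u mod n)}
      (SIGMA i:{..<m}. {x. x < n \<and> P i x})"
  proof (rule bij_betw_byWitness[where f' = "\<lambda>(i, x). i * n + x"])
    show "(\<lambda>(i, x). i * n + x) ` (SIGMA i:{..<m}. {x. x < n \<and> P i x})
        \<subseteq> {u. u < m * n \<and> P (u div n) (u mod n)}"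
    proof clarsimp
      fix i x assume *: "i < m" "x < n" "P i x"
      have "i * n + x < Suc i * n" using *(2) by simp
      also have "\<dots> \<le> m * n" using *(1) by (intro mult_le_mono1) simp
      finally show "i * n + x < m * n" .
    qed
  qed (use assms in \<open>auto simp: less_mult_imp_div_less\<close>)
  then show ?thesis
    by (simp add: bij_betw_same_card)
qed

lemma int_degree_eq:
  fixes S :: nat
  assumes "2 \<le> m" "S + w = w * q + (m - 1) * k"
  shows "int S = int w * (int q - 1) + (int m - 1) * int k"
proof -
  have "int S + int w = int w * int q + (int m - 1) * int k"
    using arg_cong[OF assms(2), of int] assms(1) by (simp add: of_nat_diff)
  then show ?thesis
    by (simp add: algebra_simps)
qed

lemma sum_except_one:
  fixes g :: "nat \<Rightarrow> nat"
  assumes "i < m" "\<And>l. l < m \<Longrightarrow> l \<noteq> i \<Longrightarrow> g l = k"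
  shows "(\<Sum>l<m. g l) = g i + (m - 1) * k"
  using assms by (subst sum.remove[of _ i]) auto

lemma sum_except_two:
  fixes g :: "nat \<Rightarrow> nat"
  assumes "i < m" "j < m" "i \<noteq> j" "\<And>l. l < m \<Longrightarrow> l \<noteq> i \<Longrightarrow> l \<noteq> j \<Longrightarrow> g l = k"
  shows "(\<Sum>l<m. g l) = g i + g j + (m - 2) * k"
  using assms by (subst sum.remove[of _ i], simp, simp, subst sum.remove[of _ j]) auto

section \<open>Arcs and paths within and between blocks\<close>

text \<open>Here \<open>m\<close> counts the blocks, and \<open>z\<close> is the degree of the
  relation \<open>N\<close> on lines. Columns below \<open>m\<close> are the private ones; the
  remaining w - 1 are common.\<close>

locale orthogonal_array_blocks = orthogonal_array +
  fixes m w z :: nat and N :: "nat \<Rightarrow> nat \<Rightarrow> bool"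
  assumes m: "2 \<le> m" and w: "1 \<le> w" and columns: "r + 1 = m + w"
    and N_less: "N a b \<Longrightarrow> a < q \<and> b < q"
    and N_out: "a < q \<Longrightarrow> card {b. N a b} = z"
    and N_in: "b < q \<Longrightarrow> card {a. N a b} = z"
    and z: "z = w \<or> z + 1 = w"
    and q: "0 < q"
begin

definition block_columns :: "nat \<Rightarrow> nat set"
  where "block_columns i = insert i {m..<r}"

text \<open>Between blocks the deciding column belongs to the target. The reverse arc depends on
  another column, so arcs there need not be reciprocated.\<close>

definition arc :: "nat \<Rightarrow> nat \<Rightarrow> nat \<Rightarrow> nat \<Rightarrow> bool"
  where "arc i x j y \<longleftrightarrow> (if i = j then adj (block_columns i) x y else N (f j x) (f j y))"

lemma block_columns:
  assumes "i < m"
  shows "block_columns i \<subseteq> {..<r}" "block_columns i \<noteq> {}" "card (block_columns i) = w"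
  using assms columns w by (auto simp: block_columns_def)

lemma less_columns: "i < m \<Longrightarrow> i < r"
  using columns w by simp

lemma card_N_out:
  assumes "c < r" "x < q\<^sup>2"
  shows "card {y. y < q\<^sup>2 \<and> N (f c x) (f c y)} = z * q"
  using card_one[OF assms(1), of "N (f c x)"] N_less N_out entry_less[OF assms] by simp

lemma card_N_in:
  assumes "c < r" "x < q\<^sup>2"
  shows "card {y. y < q\<^sup>2 \<and> N (f c y) (f c x)} = z * q"
  using card_one[OF assms(1), of "\<lambda>a. N a (f c x)"] N_less N_in entry_less[OF assms] by simp

text \<open>The conditions on the two columns are independent, giving out-degree times in-degree.
  This covers reciprocal arcs between blocks and paths whose middle block differs from both end
  blocks.\<close>

lemma card_N_N:
  assumes "c < r" "d < r" "c \<noteq> d" "x < q\<^sup>2" "y < q\<^sup>2"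
  shows "card {p. p < q\<^sup>2 \<and> N (f c x) (f c p) \<and> N (f d p) (f d y)} = z\<^sup>2"
  using card_two[OF assms(1-3), of "N (f c x)" "\<lambda>a. N a (f d y)"] N_less
    N_out[OF entry_less[OF assms(1,4)]] N_in[OF entry_less[OF assms(2,5)]]
  by (simp add: power2_eq_square)

text \<open>When \<open>c = d\<close>, the point \<open>p\<close> lies on the same line of class
  \<open>d\<close> as \<open>y\<close>, so the condition on \<open>N\<close> holds for all
  \<open>q\<close> points of that line or for none.\<close>

lemma card_class_N_out:
  assumes "c < r" "d < r" "x < q\<^sup>2" "y < q\<^sup>2"
  shows "card {p. p < q\<^sup>2 \<and> f c p = f c y \<and> N (f d x) (f d p)}
    = (if c = d then q * of_bool (N (f d x) (f d y)) else z)"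
proof (cases "c = d")
  case True
  have "{p. p < q\<^sup>2 \<and> f c p = f c y \<and> N (f d x) (f d p)}
      = (if N (f d x) (f d y) then {p. p < q\<^sup>2 \<and> f c p = f c y} else {})"
    using True by auto
  then show ?thesis
    using card_one[of c "\<lambda>a. a = f c y"] entry_less[OF assms(1,4)] assms(1) True by simp
next
  case False
  then show ?thesis
    using card_two[OF assms(1,2) False, of "\<lambda>a. a = f c y" "N (f d x)"] N_less
      entry_less[OF assms(1,4)] N_out[OF entry_less[OF assms(2,3)]] by simp
qed

lemma card_class_N_in:
  assumes "c < r" "d < r" "c \<noteq> d" "x < q\<^sup>2" "y < q\<^sup>2"
  shows "card {p. p < q\<^sup>2 \<and> f c p = f c x \<and> N (f d p) (f d y)} = z"
  using card_two[OF assms(1-3), of "\<lambda>a. a = f c x" "\<lambda>a. N a (f d y)"] N_less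
    entry_less[OF assms(1,4)] N_in[OF entry_less[OF assms(2,5)]] by simp

text \<open>Column \<open>j\<close> is not a class of block \<open>i\<close>, so each of the
  \<open>w\<close> lines through \<open>x\<close> contributes \<open>z\<close>. The added term
  accounts for \<open>x\<close> itself.\<close>

lemma card_adj_N:
  assumes ij: "i < m" "j < m" "i \<noteq> j" and xy: "x < q\<^sup>2" "y < q\<^sup>2"
  shows "card {p. p < q\<^sup>2 \<and> adj (block_columns i) x p \<and> N (f j p) (f j y)}
      + w * of_bool (N (f j x) (f j y)) = w * z"
proof -
  have "card {p. p < q\<^sup>2 \<and> f c p = f c x \<and> N (f j p) (f j y)} = z" if "c \<in> block_columns i" for c
    using that ij xy block_columns(1)[OF ij(1)] less_columns
    by (intro card_class_N_in) (auto simp: block_columns_def)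
  then show ?thesis
    using card_adj_plus[OF block_columns(1)[OF ij(1)] xy(1), of "\<lambda>p. N (f j p) (f j y)"]
    by (simp add: block_columns(3)[OF ij(1)])
qed

text \<open>Here column \<open>j\<close> is a class of the block: it contributes \<open>q\<close> or
  0, while the w - 1 common classes contribute \<open>z\<close> each.\<close>

lemma card_N_adj:
  assumes j: "j < m" and xy: "x < q\<^sup>2" "y < q\<^sup>2"
  shows "card {p. p < q\<^sup>2 \<and> N (f j x) (f j p) \<and> adj (block_columns j) p y}
      + w * of_bool (N (f j x) (f j y)) = (w - 1) * z + q * of_bool (N (f j x) (f j y))"
proof -
  have "card {p. p < q\<^sup>2 \<and> f c p = f c y \<and> N (f j x) (f j p)}
      = (if c = j then q * of_bool (N (f j x) (f j y)) else z)" if "c \<in> block_columns j" for c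
    using that j xy block_columns(1)[OF j] less_columns by (intro card_class_N_out) auto
  then have "(\<Sum>c\<in>block_columns j. card {p. p < q\<^sup>2 \<and> f c p = f c y \<and> N (f j x) (f j p)})
      = (\<Sum>c\<in>block_columns j. if c = j then q * of_bool (N (f j x) (f j y)) else z)"
    by (intro sum.cong) auto
  also have "\<dots> = q * of_bool (N (f j x) (f j y)) + (\<Sum>c\<in>{m..<r}. z)"
    unfolding block_columns_def using j by (subst sum.insert) (auto intro!: sum.cong)
  also have "(\<Sum>c\<in>{m..<r}. z) = (w - 1) * z"
  proof -
    have "r - m = w - 1" using columns w by linarith
    then show ?thesis by simp
  qed
  finally have sum: "(\<Sum>c\<in>block_columns j. card {p. p < q\<^sup>2 \<and> f c p = f c y \<and> N (f j x) (f j p)})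
      = q * of_bool (N (f j x) (f j y)) + (w - 1) * z" .
  have "{p. p < q\<^sup>2 \<and> N (f j x) (f j p) \<and> adj (block_columns j) p y}
      = {p. p < q\<^sup>2 \<and> adj (block_columns j) y p \<and> N (f j x) (f j p)}"
    using adj_sym by blast
  then show ?thesis
    using card_adj_plus[OF block_columns(1)[OF j] xy(2), of "\<lambda>p. N (f j x) (f j p)"] sum
    by (simp add: block_columns(3)[OF j])
qed

lemma arcs_out:
  assumes "i < m" "x < q\<^sup>2"
  shows "(\<Sum>l<m. card {p. p < q\<^sup>2 \<and> arc i x l p}) + w = w * q + (m - 1) * (z * q)"
proof -
  have "(\<Sum>l<m. card {p. p < q\<^sup>2 \<and> arc i x l p})
      = card {p. p < q\<^sup>2 \<and> arc i x i p} + (m - 1) * (z * q)"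
    by (rule sum_except_one[OF assms(1)]) (simp add: arc_def card_N_out less_columns assms)
  then show ?thesis
    using card_adj[OF block_columns(1)[OF assms(1)] assms(2)] block_columns(3)[OF assms(1)]
    by (simp add: arc_def)
qed

lemma arcs_in:
  assumes "i < m" "x < q\<^sup>2"
  shows "(\<Sum>l<m. card {p. p < q\<^sup>2 \<and> arc l p i x}) + w = w * q + (m - 1) * (z * q)"
proof -
  have "(\<Sum>l<m. card {p. p < q\<^sup>2 \<and> arc l p i x})
      = card {p. p < q\<^sup>2 \<and> arc i p i x} + (m - 1) * (z * q)"
    by (rule sum_except_one[OF assms(1)]) (simp add: arc_def card_N_in less_columns assms)
  moreover have "{p. p < q\<^sup>2 \<and> arc i p i x} = {p. p < q\<^sup>2 \<and> adj (block_columns i) x p}"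
    unfolding arc_def using adj_sym by auto
  ultimately show ?thesis
    using card_adj[OF block_columns(1)[OF assms(1)] assms(2)] block_columns(3)[OF assms(1)] by simp
qed

lemma arcs_reciprocal:
  assumes "i < m" "x < q\<^sup>2"
  shows "(\<Sum>l<m. card {p. p < q\<^sup>2 \<and> arc i x l p \<and> arc l p i x}) + w = w * q + (m - 1) * z\<^sup>2"
proof -
  have "(\<Sum>l<m. card {p. p < q\<^sup>2 \<and> arc i x l p \<and> arc l p i x})
      = card {p. p < q\<^sup>2 \<and> arc i x i p \<and> arc i p i x} + (m - 1) * z\<^sup>2"
    by (rule sum_except_one[OF assms(1)]) (simp add: arc_def card_N_N less_columns assms)
  moreover have "{p. p < q\<^sup>2 \<and> arc i x i p \<and> arc i p i x} = {p. p < q\<^sup>2 \<and> adj (block_columns i) x p}"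
    unfolding arc_def using adj_sym by auto
  ultimately show ?thesis
    using card_adj[OF block_columns(1)[OF assms(1)] assms(2)] block_columns(3)[OF assms(1)] by simp
qed

lemma two_paths_same_block:
  assumes i: "i < m" and xy: "x < q\<^sup>2" "y < q\<^sup>2" "x \<noteq> y"
  shows "int (\<Sum>l<m. card {p. p < q\<^sup>2 \<and> arc i x l p \<and> arc l p i y})
    = (if arc i x i y then int q + (int w)\<^sup>2 - 3 * int w else (int w)\<^sup>2 - int w)
      + (int m - 1) * (int z)\<^sup>2"
proof -
  have "(\<Sum>l<m. card {p. p < q\<^sup>2 \<and> arc i x l p \<and> arc l p i y})
      = card {p. p < q\<^sup>2 \<and> arc i x i p \<and> arc i p i y} + (m - 1) * z\<^sup>2"
    by (rule sum_except_one[OF i]) (simp add: arc_def card_N_N less_columns i xy)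
  then show ?thesis
    using card_adj_adj[OF block_columns(1,2)[OF i] xy q] block_columns(3)[OF i] m
    by (simp add: arc_def of_nat_diff)
qed

lemma two_paths_distinct_blocks:
  assumes ij: "i < m" "j < m" "i \<noteq> j" and xy: "x < q\<^sup>2" "y < q\<^sup>2"
  shows "int (\<Sum>l<m. card {p. p < q\<^sup>2 \<and> arc i x l p \<and> arc l p j y})
    = (if arc i x j y then int q + (int w)\<^sup>2 - 3 * int w else (int w)\<^sup>2 - int w)
      + (int m - 1) * (int z)\<^sup>2"
proof -
  let ?A = "card {p. p < q\<^sup>2 \<and> adj (block_columns i) x p \<and> N (f j p) (f j y)}"
  let ?B = "card {p. p < q\<^sup>2 \<and> N (f j x) (f j p) \<and> adj (block_columns j) p y}"
  let ?e = "of_bool (N (f j x) (f j y)) :: int"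
  have "(\<Sum>l<m. card {p. p < q\<^sup>2 \<and> arc i x l p \<and> arc l p j y})
      = card {p. p < q\<^sup>2 \<and> arc i x i p \<and> arc i p j y}
        + card {p. p < q\<^sup>2 \<and> arc i x j p \<and> arc j p j y} + (m - 2) * z\<^sup>2"
    by (rule sum_except_two[OF ij]) (simp add: arc_def card_N_N less_columns ij xy)
  then have "int (\<Sum>l<m. card {p. p < q\<^sup>2 \<and> arc i x l p \<and> arc l p j y})
      = int ?A + int ?B + (int m - 2) * (int z)\<^sup>2"
    using ij m by (simp add: arc_def of_nat_diff)
  moreover have "int ?A + int w * ?e = int w * int z"
    using arg_cong[OF card_adj_N[OF ij xy], of int] by (simp del: of_nat_sum)
  moreover have "int ?B + int w * ?e = (int w - 1) * int z + int q * ?e"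
    using arg_cong[OF card_N_adj[OF ij(2) xy], of int] w by (simp add: of_nat_diff)
  \<comment> \<open>This is (z - w)(z - w + 1) = 0. It trades the (2w - 1)z paths for w^2 - w and
    one further z^2, raising the factor m - 2 to the m - 1 of the single-block count.\<close>
  moreover have "(2 * int w - 1) * int z = (int w)\<^sup>2 - int w + (int z)\<^sup>2"
  proof -
    from z have "int w = int z \<or> int w = int z + 1" by linarith
    then show ?thesis
      by (elim disjE) (simp_all only: power2_eq_square, simp_all add: algebra_simps)
  qed
  moreover have "arc i x j y \<longleftrightarrow> N (f j x) (f j y)"
    using ij by (simp add: arc_def)
  ultimately show ?thesis
    by (cases "N (f j x) (f j y)") (simp_all add: algebra_simps)
qed

definition blocks_graph :: "nat pair_pre_digraph"
  where "blocks_graph = \<lparr>pverts = {..<m * q\<^sup>2},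
    parcs = {(u, v). u < m * q\<^sup>2 \<and> v < m * q\<^sup>2 \<and> arc (u div q\<^sup>2) (u mod q\<^sup>2) (v div q\<^sup>2) (v mod q\<^sup>2)}\<rparr>"

lemma directed_strongly_regular_blocks_graph:
  "directed_strongly_regular_graph blocks_graph (int m * (int q)\<^sup>2)
    (int w * (int q - 1) + (int m - 1) * int z * int q)
    (int q + (int w)\<^sup>2 - 3 * int w + (int m - 1) * (int z)\<^sup>2)
    ((int w)\<^sup>2 - int w + (int m - 1) * (int z)\<^sup>2)
    (int w * (int q - 1) + (int m - 1) * (int z)\<^sup>2)"
proof -
  have q2: "q\<^sup>2 > 0" using q by simp
  have vert: "u div q\<^sup>2 < m" "u mod q\<^sup>2 < q\<^sup>2" if "u < m * q\<^sup>2" for u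
    using that q2 by (simp_all add: less_mult_imp_div_less)
  have verts: "pverts blocks_graph = {..<m * q\<^sup>2}"
    by (simp add: blocks_graph_def)
  have arcs: "(u, v) \<in> parcs blocks_graph \<longleftrightarrow> u < m * q\<^sup>2 \<and> v < m * q\<^sup>2
      \<and> arc (u div q\<^sup>2) (u mod q\<^sup>2) (v div q\<^sup>2) (v mod q\<^sup>2)" for u v
    by (simp add: blocks_graph_def)
  have count: "card {v. v < m * q\<^sup>2 \<and> P (v div q\<^sup>2) (v mod q\<^sup>2)}
      = (\<Sum>l<m. card {p. p < q\<^sup>2 \<and> P l p})" for P
    by (rule card_div_mod[OF q2])
  show ?thesis
  proof
    fix e assume e: "e \<in> parcs blocks_graph"
    show "fst e \<in> pverts blocks_graph" "snd e \<in> pverts blocks_graph" "fst e \<noteq> snd e"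
      using e by (auto simp: blocks_graph_def arc_def adj_def)
  next
    show "finite (pverts blocks_graph)" by (simp add: verts)
    have "parcs blocks_graph \<subseteq> {..<m * q\<^sup>2} \<times> {..<m * q\<^sup>2}"
      by (auto simp: blocks_graph_def)
    then show "finite (parcs blocks_graph)"
      by (rule finite_subset) simp
    show "int (card (pverts blocks_graph)) = int m * (int q)\<^sup>2"
      by (simp add: verts)
  next
    fix u assume "u \<in> pverts blocks_graph"
    then have u: "u < m * q\<^sup>2" by (simp add: verts)
    let ?i = "u div q\<^sup>2" and ?x = "u mod q\<^sup>2"
    have "card {v. (u, v) \<in> parcs blocks_graph} + w = w * q + (m - 1) * (z * q)"
      using u arcs_out[OF vert[OF u]] by (simp add: arcs count[of "arc ?i ?x"])
    from int_degree_eq[OF m this]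
    show "int (card {v. (u, v) \<in> parcs blocks_graph})
        = int w * (int q - 1) + (int m - 1) * int z * int q"
      by simp
    have "card {v. (v, u) \<in> parcs blocks_graph} + w = w * q + (m - 1) * (z * q)"
      using u arcs_in[OF vert[OF u]] by (simp add: arcs count[of "\<lambda>l p. arc l p ?i ?x"])
    from int_degree_eq[OF m this]
    show "int (card {v. (v, u) \<in> parcs blocks_graph})
        = int w * (int q - 1) + (int m - 1) * int z * int q"
      by simp
    have "{v. (u, v) \<in> parcs blocks_graph \<and> (v, u) \<in> parcs blocks_graph}
        = {v. v < m * q\<^sup>2 \<and> arc ?i ?x (v div q\<^sup>2) (v mod q\<^sup>2)
            \<and> arc (v div q\<^sup>2) (v mod q\<^sup>2) ?i ?x}"
      using u by (auto simp: arcs)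
    then have "card {v. (u, v) \<in> parcs blocks_graph \<and> (v, u) \<in> parcs blocks_graph} + w
        = w * q + (m - 1) * z\<^sup>2"
      using arcs_reciprocal[OF vert[OF u]] by (simp add: count[of "\<lambda>l p. arc ?i ?x l p \<and> arc l p ?i ?x"])
    from int_degree_eq[OF m this]
    show "int (card {v. (u, v) \<in> parcs blocks_graph \<and> (v, u) \<in> parcs blocks_graph})
        = int w * (int q - 1) + (int m - 1) * (int z)\<^sup>2"
      by simp
    fix v assume "v \<in> pverts blocks_graph" and uv: "u \<noteq> v"
    then have v: "v < m * q\<^sup>2" by (simp add: verts)
    let ?j = "v div q\<^sup>2" and ?y = "v mod q\<^sup>2"
    have "{p. (u, p) \<in> parcs blocks_graph \<and> (p, v) \<in> parcs blocks_graph}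
        = {p. p < m * q\<^sup>2 \<and> arc ?i ?x (p div q\<^sup>2) (p mod q\<^sup>2)
            \<and> arc (p div q\<^sup>2) (p mod q\<^sup>2) ?j ?y}"
      using u v by (auto simp: arcs)
    then have "int (card {p. (u, p) \<in> parcs blocks_graph \<and> (p, v) \<in> parcs blocks_graph})
        = int (\<Sum>l<m. card {p. p < q\<^sup>2 \<and> arc ?i ?x l p \<and> arc l p ?j ?y})"
      by (simp only: count[of "\<lambda>l p. arc ?i ?x l p \<and> arc l p ?j ?y"])
    also have "\<dots> = (if arc ?i ?x ?j ?y then int q + (int w)\<^sup>2 - 3 * int w else (int w)\<^sup>2 - int w)
        + (int m - 1) * (int z)\<^sup>2"
    proof (cases "?i = ?j")
      case True
      then have "?x \<noteq> ?y"
        using uv by (metis div_mult_mod_eq)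
      then show ?thesis
        using two_paths_same_block[OF vert(1)[OF u] vert(2)[OF u] vert(2)[OF v]] True by simp
    next
      case False
      then show ?thesis
        by (intro two_paths_distinct_blocks vert u v)
    qed
    finally show "int (card {p. (u, p) \<in> parcs blocks_graph \<and> (p, v) \<in> parcs blocks_graph})
        = (if (u, v) \<in> parcs blocks_graph
           then int q + (int w)\<^sup>2 - 3 * int w + (int m - 1) * (int z)\<^sup>2
           else (int w)\<^sup>2 - int w + (int m - 1) * (int z)\<^sup>2)"
      using u v by (simp add: arcs)
  qed
qed

end

section \<open>A regular relation on the lines, and the choice of parameters\<close>

text \<open>Translation by \<open>a\<close> permutes the residues mod \<open>q\<close>, so exactly
  \<open>z\<close> of them land below \<open>z\<close>.\<close>

lemma card_add_mod_less:
  fixes q z a :: nat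
  assumes "z \<le> q"
  shows "card {b. b < q \<and> (a + b) mod q < z} = z"
proof -
  let ?g = "\<lambda>b. (a + b) mod q"
  have inj: "inj_on ?g {..<q}"
  proof (rule inj_onI)
    fix b b' assume *: "b \<in> {..<q}" "b' \<in> {..<q}" "?g b = ?g b'"
    then have "[b = b'] (mod q)"
      using cong_add_lcancel_nat[of a b b' q] by (simp add: cong_def)
    with * show "b = b'"
      by (simp add: cong_def)
  qed
  have surj: "?g ` {..<q} = {..<q}"
    by (rule endo_inj_surj[OF _ _ inj]) auto
  have "?g ` {b. b < q \<and> ?g b < z} = {..<z}"
  proof (intro equalityI subsetI)
    fix t assume t: "t \<in> {..<z}"
    then have "t \<in> ?g ` {..<q}"
      unfolding surj using assms by simp
    with t show "t \<in> ?g ` {b. b < q \<and> ?g b < z}"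
      by auto
  qed auto
  moreover have "inj_on ?g {b. b < q \<and> ?g b < z}"
    by (rule inj_on_subset[OF inj]) auto
  ultimately show ?thesis
    using card_image by fastforce
qed

theorem theorem3p1:
  fixes p s d :: nat and w z1 z2 :: int
  assumes "prime p"
    and "s > 0" and "d > 0"
    and "1 \<le> w" and "w \<le> int p ^ d"
    and "1 \<le> z1" and "z1 \<le> int p ^ d - w + 1"
    and "w = 1 \<Longrightarrow> z2 = 1"
    and "2 \<le> w \<Longrightarrow> z2 \<in> {w - 1, w}"
  shows "\<exists>G :: nat pair_pre_digraph.
    directed_strongly_regular_graph G
      ((z1 + 1) * int p ^ (2 * s * d))
      ((int p ^ (s * d) - 1) * w + z1 * z2 * int p ^ (s * d))
      (int p ^ (s * d) + w^2 - 3 * w + z1 * z2^2)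
      (w^2 - w + z1 * z2^2)
      (int p ^ (s * d) * w - w + z1 * z2^2)"
proof -
  define q where "q = p ^ (s * d)"
  \<comment> \<open>Since a + b is symmetric, a single count gives both the in-degrees and the
    out-degrees.\<close>
  define N where "N a b \<longleftrightarrow> a < q \<and> b < q \<and> (a + b) mod q < nat z2" for a b
  have "p \<ge> 1"
    using prime_gt_0_nat[OF assms(1)] by simp
  then have "p ^ d \<le> q" and q: "0 < q"
    using assms(2) unfolding q_def by (auto intro: power_increasing)
  then have "int p ^ d \<le> int q"
    by (metis of_nat_le_iff of_nat_power)
  have z2: "z2 = w \<or> z2 + 1 = w"
    using assms(4,8,9) by (cases "w = 1") auto
  then have z2_nonneg: "0 \<le> z2"
    using assms(4) by linarith
  have "0 < s * d"
    using assms(2,3) by simp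
  then obtain f where f: "orthogonal_array q (q + 1) f"
    unfolding q_def using exists_orthogonal_array[OF assms(1)] by blast
  \<comment> \<open>The bound on \<open>z1\<close> says z1 + w <= p^d + 1, and p^d <= q, so the q +
    1 parallel classes of the plane suffice.\<close>
  have "2 \<le> nat z1 + nat w" "nat z1 + nat w \<le> q + 1"
    using assms(4,6,7) \<open>int p ^ d \<le> int q\<close> by linarith+
  then interpret orthogonal_array q "nat z1 + nat w" f
    by (rule orthogonal_array.fewer_columns[OF f])
  interpret orthogonal_array_blocks q "nat z1 + nat w" f "nat z1 + 1" "nat w" "nat z2" N
  proof
    have "nat z2 \<le> q"
      using z2 assms(5) \<open>int p ^ d \<le> int q\<close> by linarith
    then have card: "card {b. b < q \<and> (a + b) mod q < nat z2} = nat z2" for a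
      by (rule card_add_mod_less)
    show "card {b. N a b} = nat z2" if "a < q" for a
      using card[of a] that by (simp add: N_def)
    show "card {a. N a b} = nat z2" if "b < q" for b
      using card[of b] that by (simp add: N_def add.commute)
  qed (use assms(4,6) z2 z2_nonneg q in \<open>auto simp: N_def\<close>)
  have "q\<^sup>2 = p ^ (2 * s * d)"
    by (simp add: q_def power_mult[symmetric] mult_ac)
  then have "(int q)\<^sup>2 = int p ^ (2 * s * d)" "int q = int p ^ (s * d)"
    by (metis of_nat_power) (simp add: q_def)
  then show ?thesis
    using directed_strongly_regular_blocks_graph assms(4,6) z2_nonneg
    by (intro exI[of _ blocks_graph]) (simp add: algebra_simps)
qed

end
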